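(* Let $X,Y$ be topological spaces and let $f:X\to Y$ be a continuous map. Then $\mathrm{cat}(f)\le\min\{\mathrm{cat}(X),\mathrm{cat}(Y)\}$.
   Context: A continuous map is null-homotopic if it is (freely) homotopic to a constant map. The category $\mathrm{cat}(f)$ of a continuous map $f:X\to Y$ is the least positive integer $n$ such that $X$ is a union of open subsets $U_1,\dots,U_n$ with each restriction $f_{|U_i}:U_i\to Y$ null-homotopic, and $\infty$ if no such integer exists. The LS category $\mathrm{cat}(X)$ of a space $X$ is the least positive integer $k$ such that $X$ is a union of open subsets $U_1,\dots,U_k$ with each inclusion $U_j\hookrightarrow X$ null-homotopic, and $\infty$ if no such integer exists. *)

theory Defs
  imports "HOL-Analysis.Analysis"
begin

text \<open>Spaces are abstract topologies, and a continuous map from \<open>X\<close> to \<open>Y\<close> is a function \<open>f\<close>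
  with \<open>continuous_map X Y f\<close>. As in \<^const>\<open>contractible_space\<close>, the value \<open>c\<close> of the
  constant map is not explicitly required to be a point of \<open>Y\<close>: this follows from continuity if
  \<open>X\<close> is nonempty, and the empty map is considered constant.\<close>

definition null_homotopic :: "'a topology \<Rightarrow> 'b topology \<Rightarrow> ('a \<Rightarrow> 'b) \<Rightarrow> bool" where
  "null_homotopic X Y f \<longleftrightarrow> (\<exists>c. homotopic_with (\<lambda>_. True) X Y f (\<lambda>_. c))"

definition map_cat_cover :: "'a topology \<Rightarrow> 'b topology \<Rightarrow> ('a \<Rightarrow> 'b) \<Rightarrow> nat \<Rightarrow> bool" where
  "map_cat_cover X Y f n \<longleftrightarrow>
     (\<exists>U :: nat \<Rightarrow> 'a set.
        (\<forall>i\<in>{1..n}. openin X (U i)) \<and>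
        topspace X = (\<Union>i\<in>{1..n}. U i) \<and>
        (\<forall>i\<in>{1..n}. null_homotopic (subtopology X (U i)) Y f))"

definition map_cat :: "'a topology \<Rightarrow> 'b topology \<Rightarrow> ('a \<Rightarrow> 'b) \<Rightarrow> enat" where
  "map_cat X Y f =
     (if \<exists>n\<ge>1. map_cat_cover X Y f n
      then enat (LEAST n. n \<ge> 1 \<and> map_cat_cover X Y f n) else \<infinity>)"

definition LS_cat_cover :: "'a topology \<Rightarrow> nat \<Rightarrow> bool" where
  "LS_cat_cover X k \<longleftrightarrow>
     (\<exists>U :: nat \<Rightarrow> 'a set.
        (\<forall>j\<in>{1..k}. openin X (U j)) \<and>
        topspace X = (\<Union>j\<in>{1..k}. U j) \<and>
        (\<forall>j\<in>{1..k}. null_homotopic (subtopology X (U j)) X (\<lambda>x. x)))"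

definition LS_cat :: "'a topology \<Rightarrow> enat" where
  "LS_cat X =
     (if \<exists>k\<ge>1. LS_cat_cover X k
      then enat (LEAST k. k \<ge> 1 \<and> LS_cat_cover X k) else \<infinity>)"

end

theory Submission
  imports Defs
begin

text \<open>Composing a null-homotopic map with a continuous map on either side leaves it
  null-homotopic. On an open set U whose inclusion into \<open>X\<close> is null-homotopic, the
  restriction of \<open>f\<close> is \<open>f\<close> after that inclusion, so a categorical cover
  of \<open>X\<close> already serves for \<open>f\<close>. A categorical cover of \<open>Y\<close>
  pulls back along \<open>f\<close> to an open cover of \<open>X\<close>: on the preimage of V,
  \<open>f\<close> factors through the inclusion of V into \<open>Y\<close>. Either way the number
  of sets is kept, so each LS category bounds the category of \<open>f\<close>
  (\<open>map_cat_le_LS_cat\<close>).\<close>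

lemma null_homotopic_compose_left:
  assumes "null_homotopic X Y f" "continuous_map Y Z g"
  shows "null_homotopic X Z (g \<circ> f)"
proof -
  obtain c where "homotopic_with (\<lambda>_. True) X Y f (\<lambda>_. c)"
    using assms(1) by (auto simp: null_homotopic_def)
  then have "homotopic_with (\<lambda>_. True) X Z (g \<circ> f) (g \<circ> (\<lambda>_. c))"
    by (rule homotopic_with_compose_continuous_map_left) (use assms(2) in auto)
  then show ?thesis
    by (auto simp: null_homotopic_def o_def)
qed

lemma null_homotopic_compose_right:
  assumes "null_homotopic Y Z g" "continuous_map X Y f"
  shows "null_homotopic X Z (g \<circ> f)"
proof -
  obtain c where "homotopic_with (\<lambda>_. True) Y Z g (\<lambda>_. c)"
    using assms(1) by (auto simp: null_homotopic_def)
  then have "homotopic_with (\<lambda>_. True) X Z (g \<circ> f) ((\<lambda>_. c) \<circ> f)"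
    by (rule homotopic_with_compose_continuous_map_right) (use assms(2) in auto)
  then show ?thesis
    by (auto simp: null_homotopic_def o_def)
qed

text \<open>The same open sets work, by postcomposing each contracted inclusion with
  \<open>f\<close>.\<close>

lemma map_cat_cover_if_LS_cat_cover_domain:
  assumes f: "continuous_map X Y f" and "LS_cat_cover X n"
  shows "map_cat_cover X Y f n"
proof -
  have "null_homotopic (subtopology X V) Y f"
    if "null_homotopic (subtopology X V) X (\<lambda>x. x)" for V
    using null_homotopic_compose_left[OF that f] by (simp add: o_def)
  moreover obtain U where "\<forall>i\<in>{1..n}. openin X (U i)" "topspace X = (\<Union>i\<in>{1..n}. U i)"
      "\<forall>i\<in>{1..n}. null_homotopic (subtopology X (U i)) X (\<lambda>x. x)"
    using assms(2) unfolding LS_cat_cover_def by blast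
  ultimately show ?thesis
    unfolding map_cat_cover_def by (intro exI[of _ U]) metis
qed

lemma map_cat_cover_if_LS_cat_cover_codomain:
  assumes f: "continuous_map X Y f" and "LS_cat_cover Y n"
  shows "map_cat_cover X Y f n"
proof -
  obtain V where V: "\<forall>i\<in>{1..n}. openin Y (V i)" "topspace Y = (\<Union>i\<in>{1..n}. V i)"
      "\<forall>i\<in>{1..n}. null_homotopic (subtopology Y (V i)) Y (\<lambda>y. y)"
    using assms(2) unfolding LS_cat_cover_def by blast
  \<comment> \<open>The preimages under \<open>f\<close> of the sets covering \<open>Y\<close>; some
    may be empty, which is harmless as they are only indexed.\<close>
  define U where "U i = {x \<in> topspace X. f x \<in> V i}" for i
  have "\<forall>i\<in>{1..n}. openin X (U i)"
    using V(1) f unfolding U_def by (blast intro: openin_continuous_map_preimage)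
  moreover have "topspace X = (\<Union>i\<in>{1..n}. U i)"
    using V(2) continuous_map_image_subset_topspace[OF f] unfolding U_def by blast
  moreover have "\<forall>i\<in>{1..n}. null_homotopic (subtopology X (U i)) Y f"
  proof
    fix i assume "i \<in> {1..n}"
    \<comment> \<open>Restricting the codomain too lets \<open>f\<close> be precomposed with the
      null-homotopic inclusion of \<open>V i\<close> into \<open>Y\<close>.\<close>
    moreover have "continuous_map (subtopology X (U i)) (subtopology Y (V i)) f"
      using f by (auto simp: continuous_map_in_subtopology continuous_map_from_subtopology U_def)
    ultimately show "null_homotopic (subtopology X (U i)) Y f"
      using V(3) null_homotopic_compose_right[of _ Y "\<lambda>y. y"] by (fastforce simp: o_def)
  qed
  ultimately show ?thesis
    unfolding map_cat_cover_def by blast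
qed

text \<open>Passes from covers to minima: a cover of least size for \<open>Z\<close> yields one of
  that size for \<open>f\<close>. The space \<open>Z\<close> is arbitrary, so that both
  \<open>X\<close> and \<open>Y\<close> can be put for it.\<close>

lemma map_cat_le_LS_cat:
  assumes "\<And>n. LS_cat_cover Z n \<Longrightarrow> map_cat_cover X Y f n"
  shows "map_cat X Y f \<le> LS_cat Z"
proof (cases "\<exists>n\<ge>1. LS_cat_cover Z n")
  case True
  define k where "k = (LEAST k. k \<ge> 1 \<and> LS_cat_cover Z k)"
  have "k \<ge> 1 \<and> LS_cat_cover Z k"
    unfolding k_def using True by (metis (mono_tags, lifting) LeastI)
  then have k: "k \<ge> 1 \<and> map_cat_cover X Y f k"
    using assms by blast
  then have "map_cat X Y f \<le> enat k"
    unfolding map_cat_def by (auto intro: Least_le)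
  then show ?thesis
    using True by (simp add: LS_cat_def k_def)
next
  case False
  then have "LS_cat Z = \<infinity>"
    unfolding LS_cat_def by (rule if_not_P)
  then show ?thesis
    by simp
qed

theorem mainTheorem12:
  fixes X :: "'a topology" and Y :: "'b topology" and f :: "'a \<Rightarrow> 'b"
  assumes "continuous_map X Y f"
  shows "map_cat X Y f \<le> min (LS_cat X) (LS_cat Y)"
  using assms map_cat_le_LS_cat map_cat_cover_if_LS_cat_cover_domain
    map_cat_cover_if_LS_cat_cover_codomain
  by (metis min.boundedI)

end
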